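(* Let $n\ge 2$, let $q\in\mathbb N$, let $s_1,\dots,s_n\in\mathbb Z$ satisfy $\gcd(q,s_1,\dots,s_n)=1$, let $L=L(q;s_1,\dots,s_n)$ be the corresponding lens orbifold of dimension $2n-1$, and let $\mathcal L=\mathcal L(q;s_1,\dots,s_n)$ be its associated congruence lattice. Then the spectral generating function $F_L(z)$ of $L$ and the one-norm theta function $\vartheta_{\mathcal L}(z)$ of $\mathcal L$ satisfy (as formal power series in $z$) $$F_L(z)=\frac{\vartheta_{\mathcal L}(z)}{(1-z^2)^{n-1}}.$$
   Context: Lens orbifolds: for $q\in\mathbb N$ and $s_1,\dots,s_n\in\mathbb Z$ with $\gcd(q,s_1,\dots,s_n)=1$, let $\gamma\in \mathrm{SO}(2n)$ be the block diagonal matrix with $2\times 2$ diagonal blocks $\begin{pmatrix}\cos(2\pi s_j/q)&\sin(2\pi s_j/q)\\-\sin(2\pi s_j/q)&\cos(2\pi s_j/q)\end{pmatrix}$, $j=1,\dots,n$. It has order $q$. Put $\Gamma=\langle\gamma\rangle$. The lens orbifold is $L(q;s_1,\dots,s_n):=\Gamma\backslash S^{2n-1}$, where $S^{2n-1}$ is the unit sphere in $\mathbb R^{2n}$ (it is a lens space, i.e. a manifold with $\Gamma$ acting freely, when $\gcd(q,s_j)=1$ for all $j$). Spectral generating function: for $k\ge 0$ let $\mathcal H_k$ be the space of harmonic homogeneous complex polynomials of degree $k$ in $2n$ real variables. The group $\mathrm{SO}(2n)$ acts on $\mathcal H_k$ by $(g\cdot f)(x)=f(g^{-1}x)$, and $\mathcal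 H_k^\Gamma$ denotes the subspace of $\Gamma$-invariants. (Then $\dim\mathcal H_k^\Gamma$ is the multiplicity of $k(k+2n-2)$ in the spectrum of the Laplace--Beltrami operator on functions on $\Gamma\backslash S^{2n-1}$.) Define $F_L(z)=F_\Gamma(z):=\sum_{k\ge0}\dim \mathcal H_k^\Gamma\, z^k$. Congruence lattice: $\mathcal L(q;s_1,\dots,s_n):=\{(a_1,\dots,a_n)\in\mathbb Z^n: a_1s_1+\dots+a_ns_n\equiv 0\pmod q\}$. One-norm theta function: with $\|(a_1,\dots,a_n)\|_1=|a_1|+\dots+|a_n|$ and $N_{\mathcal L}(k)=\#\{\mu\in\mathcal L:\|\mu\|_1=k\}$, set $\vartheta_{\mathcal L}(z):=\sum_{k\ge0}N_{\mathcal L}(k)\,z^k$. *)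

theory Defs
  imports
    "HOL-Analysis.Analysis"
    "HOL-Algebra.Generated_Groups"
    "HOL-Number_Theory.Cong"
    "HOL-Computational_Algebra.Formal_Power_Series"
    "HOL-Library.Function_Algebras"
begin

definition SO_group :: "(real ^ 'm ^ 'm) monoid" where
  "SO_group = \<lparr>carrier = {A. orthogonal_matrix A \<and> det A = 1}, mult = (**), one = mat 1\<rparr>"

text \<open>
  Polynomials are identified with the functions they induce on real space. A homogeneous
  polynomial of degree \<open>k\<close> is a complex linear combination of monomials of total degree \<open>k\<close>.
\<close>

definition homogeneous_poly :: "nat \<Rightarrow> (real ^ 'm \<Rightarrow> complex) set" where
  "homogeneous_poly k =
     {f. \<exists>c :: ('m \<Rightarrow> nat) \<Rightarrow> complex.
        f = (\<lambda>x. \<Sum>\<alpha> | (\<Sum>i\<in>UNIV. \<alpha> i) = k. c \<alpha> * of_real (\<Prod>i\<in>UNIV. (x $ i) ^ \<alpha> i))}"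

definition partial_deriv :: "'m \<Rightarrow> (real ^ 'm \<Rightarrow> complex) \<Rightarrow> real ^ 'm \<Rightarrow> complex" where
  "partial_deriv i f x = vector_derivative (\<lambda>t. f (x + t *\<^sub>R axis i 1)) (at 0)"

definition laplacian :: "(real ^ 'm \<Rightarrow> complex) \<Rightarrow> real ^ 'm \<Rightarrow> complex" where
  "laplacian f x = (\<Sum>i\<in>UNIV. partial_deriv i (partial_deriv i f) x)"

definition harmonic_poly :: "nat \<Rightarrow> (real ^ 'm \<Rightarrow> complex) set" where
  "harmonic_poly k = {f \<in> homogeneous_poly k. \<forall>x. laplacian f x = 0}"

definition act :: "real ^ 'm ^ 'm \<Rightarrow> (real ^ 'm \<Rightarrow> complex) \<Rightarrow> real ^ 'm \<Rightarrow> complex" where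
  "act g f x = f (matrix_inv g *v x)"

definition harmonic_invariants ::
    "(real ^ 'm ^ 'm) set \<Rightarrow> nat \<Rightarrow> (real ^ 'm \<Rightarrow> complex) set" where
  "harmonic_invariants \<Gamma> k = {f \<in> harmonic_poly k. \<forall>g\<in>\<Gamma>. act g f = f}"

definition fun_scale :: "complex \<Rightarrow> ('a \<Rightarrow> complex) \<Rightarrow> 'a \<Rightarrow> complex" where
  "fun_scale c f x = c * f x"

interpretation cfun: vector_space fun_scale
  by unfold_locales (auto simp: fun_scale_def fun_eq_iff algebra_simps)

definition spectral_gf :: "(real ^ 'm ^ 'm) set \<Rightarrow> real fps" where
  "spectral_gf \<Gamma> = Abs_fps (\<lambda>k. of_nat (cfun.dim (harmonic_invariants \<Gamma> k)))"

text \<open>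
  The \<open>2n\<close> real coordinates are indexed by \<open>'n \<times> 2\<close>, where \<open>CARD('n) = n\<close>: the coordinates
  \<open>(j, 1)\<close> and \<open>(j, 2)\<close> belong to the \<open>j\<close>-th diagonal block.
\<close>

definition lens_matrix :: "nat \<Rightarrow> int ^ 'n \<Rightarrow> real ^ ('n \<times> 2) ^ ('n \<times> 2)" where
  "lens_matrix q s = (\<chi> u v.
     if fst u \<noteq> fst v then 0
     else let \<theta> = 2 * pi * of_int (s $ fst u) / of_nat q in
       vector [vector [cos \<theta>, sin \<theta>], vector [- sin \<theta>, cos \<theta>]] $ snd u $ snd v)"

definition lens_group :: "nat \<Rightarrow> int ^ 'n \<Rightarrow> (real ^ ('n \<times> 2) ^ ('n \<times> 2)) set" where
  "lens_group q s = generate SO_group {lens_matrix q s}"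

text \<open>
  By definition, the spectral generating function of the lens orbifold, the quotient of the unit
  sphere by \<open>lens_group q s\<close>, depends only on this group acting on harmonic polynomials.
\<close>

definition lens_spectral_gf :: "nat \<Rightarrow> int ^ 'n \<Rightarrow> real fps" where
  "lens_spectral_gf q s = spectral_gf (lens_group q s)"

definition congruence_lattice :: "nat \<Rightarrow> int ^ 'n \<Rightarrow> (int ^ 'n) set" where
  "congruence_lattice q s = {a. [(\<Sum>j\<in>UNIV. a $ j * s $ j) = 0] (mod int q)}"

definition one_norm :: "int ^ 'n \<Rightarrow> int" where
  "one_norm a = (\<Sum>j\<in>UNIV. \<bar>a $ j\<bar>)"

definition one_norm_theta :: "(int ^ 'n) set \<Rightarrow> real fps" where
  "one_norm_theta \<L> = Abs_fps (\<lambda>k. of_nat (card {\<mu> \<in> \<L>. one_norm \<mu> = int k}))"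

end

theory Submission
  imports Defs "HOL-Library.Real_Mod"
begin

text \<open>
  In the complex coordinates \<open>z\<^sub>j\<close> and their conjugates \<open>w\<^sub>j\<close>, the group acts diagonally on the
  monomials \<open>z\<^sup>a w\<^sup>b\<close>, and such a monomial is invariant iff \<open>a - b\<close> lies in the congruence lattice. The
  Laplacian preserves \<open>a - b\<close>; a polynomial is harmonic iff its coefficients \<open>c\<close> satisfy, for every
  exponent, a relation whose terms are the values of \<open>c\<close> at that exponent with \<open>z\<^sub>j w\<^sub>j\<close> multiplied in, one
  term for each \<open>j\<close>, with positive factors. Solving these relations for the term of one fixed index \<open>k\<close> shows
  that \<open>c\<close> is determined by its values, which can be prescribed, at the monomials not divisible by
  \<open>z\<^sub>k w\<^sub>k\<close>. So the dimension counts the invariant monomials not divisible by \<open>z\<^sub>k w\<^sub>k\<close>. Each of these is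
  uniquely a product of powers of the \<open>z\<^sub>j w\<^sub>j\<close>, \<open>j \<noteq> k\<close>, which contribute the factor
  \<open>1 / (1 - z\<^sup>2)\<^sup>n\<^sup>-\<^sup>1\<close>, and a monomial divisible by no \<open>z\<^sub>j w\<^sub>j\<close>, which is a lattice point whose
  one-norm is the degree.
\<close>

section \<open>Polynomials in complex coordinates\<close>

text \<open>In an independent indexed family a repeated vector would give a nontrivial relation, so
  counting the indices of an indexed basis counts its vectors.\<close>

lemma cfun_dim_eq_card:
  fixes v :: "'b \<Rightarrow> 'a \<Rightarrow> complex"
  assumes B: "finite B" and mem: "\<And>b. b \<in> B \<Longrightarrow> v b \<in> V"
    and gen: "\<And>f. f \<in> V \<Longrightarrow> \<exists>c. \<forall>x. f x = (\<Sum>b\<in>B. c b * v b x)"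
    and ind: "\<And>c b. (\<And>x. (\<Sum>b\<in>B. c b * v b x) = 0) \<Longrightarrow> b \<in> B \<Longrightarrow> c b = 0"
  shows "cfun.dim V = card B"
proof -
  have app: "(\<Sum>b\<in>A. fun_scale (c b) (w b)) x = (\<Sum>b\<in>A. c b * w b x)"
    for A c and w :: "'c \<Rightarrow> 'a \<Rightarrow> complex" and x
    by (induction A rule: infinite_finite_induct) (auto simp: fun_scale_def)
  have inj: "inj_on v B"
  proof (rule inj_onI, rule ccontr)
    fix a b assume ab: "a \<in> B" "b \<in> B" "v a = v b" "a \<noteq> b"
    let ?c = "\<lambda>i. if i = a then 1 else if i = b then -1 else (0::complex)"
    have "(\<Sum>i\<in>B. ?c i * v i x) = 0" for x
    proof -
      have "(\<Sum>i\<in>B. ?c i * v i x) = (\<Sum>i\<in>{a,b}. ?c i * v i x)"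
        using ab B by (intro sum.mono_neutral_right) auto
      also have "\<dots> = 0" using ab by simp
      finally show ?thesis .
    qed
    from ind[of ?c a, OF this ab(1)] show False by simp
  qed
  have "cfun.independent (v ` B)"
  proof (rule cfun.independent_if_scalars_zero)
    fix g y assume g: "(\<Sum>y\<in>v ` B. fun_scale (g y) y) = 0" and y: "y \<in> v ` B"
    obtain b where b: "b \<in> B" "y = v b" using y by auto
    have "(\<Sum>b\<in>B. g (v b) * v b x) = 0" for x
    proof -
      have "(\<Sum>b\<in>B. fun_scale (g (v b)) (v b)) x = 0"
        using g inj by (simp add: sum.reindex)
      then show ?thesis by (simp add: app)
    qed
    from ind[of "\<lambda>b. g (v b)", OF this b(1)] show "g y = 0" using b by simp
  qed (use B in simp)
  moreover have "V \<subseteq> cfun.span (v ` B)"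
  proof
    fix f assume "f \<in> V"
    then obtain c where "\<forall>x. f x = (\<Sum>b\<in>B. c b * v b x)" using gen by blast
    then have "f = (\<Sum>b\<in>B. fun_scale (c b) (v b))" by (intro ext) (simp add: app)
    then show "f \<in> cfun.span (v ` B)"
      by (simp add: cfun.span_sum cfun.span_scale cfun.span_base)
  qed
  ultimately show ?thesis
    using mem inj by (intro cfun.dim_unique[of "v ` B"]) (auto simp: card_image)
qed

lemma finite_functions_sum_eq: "finite {\<alpha> :: 'i::finite \<Rightarrow> nat. sum \<alpha> UNIV = k}"
proof (rule finite_subset)
  show "{\<alpha> :: 'i \<Rightarrow> nat. sum \<alpha> UNIV = k} \<subseteq> {\<alpha>. \<alpha> \<in> UNIV \<rightarrow>\<^sub>E {..k}}"
    by (auto intro!: member_le_sum)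
  show "finite {\<alpha> :: 'i \<Rightarrow> nat. \<alpha> \<in> UNIV \<rightarrow>\<^sub>E {..k}}"
    by (simp add: finite_PiE)
qed

text \<open>Keeping the family \<open>l\<close> arbitrary makes the real and the complex coordinates
  two instances, so that changing coordinates means comparing two such spans.\<close>

definition polspan :: "('i::finite \<Rightarrow> 'x \<Rightarrow> complex) \<Rightarrow> nat \<Rightarrow> ('x \<Rightarrow> complex) set" where
  "polspan l k = {f. \<exists>c. f = (\<lambda>x. \<Sum>\<alpha> | sum \<alpha> UNIV = k. c \<alpha> * (\<Prod>i\<in>UNIV. l i x ^ \<alpha> i))}"

lemma polspan_add: "f \<in> polspan l k \<Longrightarrow> g \<in> polspan l k \<Longrightarrow> (\<lambda>x. f x + g x) \<in> polspan l k"
  unfolding polspan_def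
proof clarsimp
  fix c d
  show "\<exists>e. (\<lambda>x. (\<Sum>\<alpha> | sum \<alpha> UNIV = k. c \<alpha> * (\<Prod>i\<in>UNIV. l i x ^ \<alpha> i)) +
             (\<Sum>\<alpha> | sum \<alpha> UNIV = k. d \<alpha> * (\<Prod>i\<in>UNIV. l i x ^ \<alpha> i))) =
        (\<lambda>x. \<Sum>\<alpha> | sum \<alpha> UNIV = k. e \<alpha> * (\<Prod>i\<in>UNIV. l i x ^ \<alpha> i))"
    by (rule exI[of _ "\<lambda>\<alpha>. c \<alpha> + d \<alpha>"]) (simp add: distrib_right sum.distrib)
qed

lemma polspan_scale: "f \<in> polspan l k \<Longrightarrow> (\<lambda>x. a * f x) \<in> polspan l k"
  unfolding polspan_def
proof clarsimp
  fix c
  show "\<exists>e. (\<lambda>x. a * (\<Sum>\<alpha> | sum \<alpha> UNIV = k. c \<alpha> * (\<Prod>i\<in>UNIV. l i x ^ \<alpha> i))) =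
        (\<lambda>x. \<Sum>\<alpha> | sum \<alpha> UNIV = k. e \<alpha> * (\<Prod>i\<in>UNIV. l i x ^ \<alpha> i))"
    by (rule exI[of _ "\<lambda>\<alpha>. a * c \<alpha>"]) (simp add: sum_distrib_left mult.assoc)
qed

lemma polspan_sum:
  assumes "\<And>a. a \<in> A \<Longrightarrow> f a \<in> polspan l k"
  shows "(\<lambda>x. \<Sum>a\<in>A. f a x) \<in> polspan l k"
proof -
  have 0: "(\<lambda>x. 0) \<in> polspan l k"
    unfolding polspan_def by (auto intro!: exI[of _ "\<lambda>_. 0"])
  show ?thesis
    using assms by (induction A rule: infinite_finite_induct) (auto simp: 0 intro!: polspan_add)
qed

lemma polspan_monomial: "sum \<alpha> UNIV = k \<Longrightarrow> (\<lambda>x. \<Prod>i\<in>UNIV. l i x ^ \<alpha> i) \<in> polspan l k"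
  unfolding polspan_def
  by (auto intro!: exI[of _ "\<lambda>\<beta>. if \<beta> = \<alpha> then 1 else 0"]
      simp: finite_functions_sum_eq if_distrib[of "\<lambda>x. x * _"] cong: if_cong)

text \<open>Exponents add. Different pairs may have the same sum, so the closure properties are used
  instead of collecting coefficients.\<close>

lemma polspan_mult:
  assumes f: "f \<in> polspan l k" and g: "g \<in> polspan l m"
  shows "(\<lambda>x. f x * g x) \<in> polspan l (k + m)"
proof -
  obtain c where c: "f = (\<lambda>x. \<Sum>\<alpha> | sum \<alpha> UNIV = k. c \<alpha> * (\<Prod>i\<in>UNIV. l i x ^ \<alpha> i))"
    using f unfolding polspan_def by blast
  obtain d where d: "g = (\<lambda>x. \<Sum>\<alpha> | sum \<alpha> UNIV = m. d \<alpha> * (\<Prod>i\<in>UNIV. l i x ^ \<alpha> i))"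
    using g unfolding polspan_def by blast
  have "(\<lambda>x. f x * g x) = (\<lambda>x. \<Sum>\<alpha> | sum \<alpha> UNIV = k. \<Sum>\<beta> | sum \<beta> UNIV = m.
      (c \<alpha> * d \<beta>) * (\<Prod>i\<in>UNIV. l i x ^ (\<alpha> i + \<beta> i)))"
    unfolding c d by (simp add: sum_product power_add prod.distrib mult_ac)
  also have "\<dots> \<in> polspan l (k + m)"
    by (intro polspan_sum polspan_scale polspan_monomial) (auto simp: sum.distrib)
  finally show ?thesis .
qed

lemma polspan_power: "f \<in> polspan l 1 \<Longrightarrow> (\<lambda>x. f x ^ m) \<in> polspan l m"
proof (induction m)
  case 0
  show ?case using polspan_monomial[of "\<lambda>_. 0" 0 l] by simp
next
  case (Suc m)
  then show ?case using polspan_mult[of f l 1 "\<lambda>x. f x ^ m" m] by simp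
qed

lemma polspan_prod:
  assumes "\<And>i. i \<in> A \<Longrightarrow> f i \<in> polspan l 1"
  shows "(\<lambda>x. \<Prod>i\<in>A. f i x ^ \<alpha> i) \<in> polspan l (sum \<alpha> A)"
proof -
  have 1: "(\<lambda>x. 1) \<in> polspan l 0" using polspan_monomial[of "\<lambda>_. 0" 0 l] by simp
  show ?thesis
    using assms
    by (induction A rule: infinite_finite_induct) (auto simp: 1 intro!: polspan_mult polspan_power)
qed

lemma polspan_generator: "l i \<in> polspan l 1"
proof -
  have "(\<Prod>j\<in>UNIV. l j x ^ (if j = i then 1 else 0)) = l i x" for x
    by (simp add: if_distrib[of "\<lambda>n. _ ^ n"] cong: if_cong)
  then show ?thesis using polspan_monomial[of "\<lambda>j. if j = i then 1 else 0" 1 l] by simp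
qed

text \<open>Substituting linear forms preserves the degree, so two families need only be compared in
  degree 1.\<close>

lemma polspan_subset:
  assumes "\<And>i. l i \<in> polspan m 1"
  shows "polspan l k \<subseteq> polspan m k"
proof
  fix f assume "f \<in> polspan l k"
  then obtain c where c: "f = (\<lambda>x. \<Sum>\<alpha> | sum \<alpha> UNIV = k. c \<alpha> * (\<Prod>i\<in>UNIV. l i x ^ \<alpha> i))"
    unfolding polspan_def by blast
  have "(\<lambda>x. \<Prod>i\<in>UNIV. l i x ^ \<alpha> i) \<in> polspan m k" if "sum \<alpha> UNIV = k" for \<alpha>
    using polspan_prod[of UNIV l m \<alpha>] assms that by auto
  then show "f \<in> polspan m k"
    unfolding c by (auto intro!: polspan_sum polspan_scale)
qed

text \<open>The index \<open>(j, 1)\<close> stands for \<open>z\<^sub>j\<close>, and \<open>(j, 2)\<close> for its conjugate \<open>w\<^sub>j\<close>.\<close>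

definition zcoord :: "'n::finite \<times> 2 \<Rightarrow> real ^ ('n \<times> 2) \<Rightarrow> complex" where
  "zcoord u x = Complex (x $ (fst u, 1)) (if snd u = 1 then x $ (fst u, 2) else - x $ (fst u, 2))"

definition zmono :: "('n::finite \<times> 2 \<Rightarrow> nat) \<Rightarrow> real ^ ('n \<times> 2) \<Rightarrow> complex" where
  "zmono \<alpha> x = (\<Prod>u\<in>UNIV. zcoord u x ^ \<alpha> u)"

text \<open>Each kind of coordinate is a linear combination of the other: for
  \<open>z = x + i y\<close> and \<open>w = x - i y\<close> one has \<open>x = (z + w) / 2\<close>
  and \<open>y = (z - w) / (2 i)\<close>.\<close>

lemma homogeneous_poly_eq:
  "homogeneous_poly k =
    {f. \<exists>c. f = (\<lambda>x::real ^ ('n::finite \<times> 2). \<Sum>\<alpha> | sum \<alpha> UNIV = k. c \<alpha> * zmono \<alpha> x)}"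
proof -
  let ?x = "\<lambda>(i::'n \<times> 2) (x :: real ^ ('n \<times> 2)). complex_of_real (x $ i)"
  have 1: "?x i \<in> polspan zcoord 1" for i
  proof -
    obtain j a where i: "i = (j, a)" by (cases i)
    have eq: "?x (j, 1) = (\<lambda>x. (1/2) * zcoord (j, 1) x + (1/2) * zcoord (j, 2) x)"
      "?x (j, 2) = (\<lambda>x. (-\<i>/2) * zcoord (j, 1) x + (\<i>/2) * zcoord (j, 2) x)"
      by (auto simp: fun_eq_iff zcoord_def complex_eq_iff)
    show ?thesis
      using exhaust_2[of a] unfolding i
      by (auto simp only: eq intro!: polspan_add polspan_scale polspan_generator)
  qed
  have 2: "zcoord i \<in> polspan ?x 1" for i :: "'n \<times> 2"
  proof -
    obtain j a where i: "i = (j, a)" by (cases i)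
    have eq: "zcoord (j, 1) = (\<lambda>x. ?x (j, 1) x + \<i> * ?x (j, 2) x)"
      "zcoord (j, 2) = (\<lambda>x. ?x (j, 1) x + (-\<i>) * ?x (j, 2) x)"
      by (auto simp: fun_eq_iff zcoord_def complex_eq_iff)
    show ?thesis
      using exhaust_2[of a] unfolding i
      by (auto simp only: eq intro!: polspan_add polspan_scale polspan_generator[of ?x])
  qed
  have "homogeneous_poly k = polspan ?x k"
    unfolding homogeneous_poly_def polspan_def by simp
  also have "\<dots> = polspan zcoord k"
    using polspan_subset[of ?x zcoord k] polspan_subset[of zcoord ?x k] 1 2 by blast
  finally show ?thesis unfolding polspan_def zmono_def .
qed

section \<open>Linear independence of the monomials\<close>

lemma sum_pair_2: "(\<Sum>u\<in>UNIV. g u) = (\<Sum>j\<in>UNIV. g (j, 1) + g (j, 2 :: 2))"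
  for g :: "'n::finite \<times> 2 \<Rightarrow> 'a::comm_monoid_add"
proof -
  have "(\<Sum>u\<in>UNIV. g u) = (\<Sum>j\<in>UNIV. \<Sum>i\<in>UNIV. g (j, i))"
    by (simp add: sum.cartesian_product)
  then show ?thesis by (simp add: UNIV_2)
qed

lemma prod_pair_2: "(\<Prod>u\<in>UNIV. g u) = (\<Prod>j\<in>UNIV. g (j, 1) * g (j, 2 :: 2))"
  for g :: "'n::finite \<times> 2 \<Rightarrow> 'a::comm_monoid_mult"
proof -
  have "(\<Prod>u\<in>UNIV. g u) = (\<Prod>j\<in>UNIV. \<Prod>i\<in>UNIV. g (j, i))"
    by (simp add: prod.cartesian_product)
  then show ?thesis by (simp add: UNIV_2)
qed

lemma zmono_eigen:
  assumes "\<And>u. zcoord u y = m u * zcoord u x"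
  shows "zmono \<alpha> y = (\<Prod>u\<in>UNIV. m u ^ \<alpha> u) * zmono \<alpha> x"
  by (simp add: zmono_def assms power_mult_distrib prod.distrib)

text \<open>Multiplying \<open>z_j\<close> by \<open>a\<close>, hence \<open>w_j\<close> by its
  conjugate, scales the monomial of \<gamma> by
  \<open>a ^ \<gamma> (j, 1) * cnj a ^ \<gamma> (j, 2)\<close>. If the degrees in block
  \<open>j\<close> differ, \<open>a = 2\<close> separates the two monomials; otherwise a point of
  the unit circle does.\<close>

lemma zmono_separate:
  fixes \<alpha> \<beta> :: "'n::finite \<times> 2 \<Rightarrow> nat"
  assumes "\<alpha> \<noteq> \<beta>"
  shows "\<exists>T e. (\<forall>\<gamma> x. zmono \<gamma> (T x) = e \<gamma> * zmono \<gamma> x) \<and> e \<alpha> \<noteq> e \<beta>"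
proof -
  obtain j i where "\<alpha> (j, i) \<noteq> \<beta> (j, i)" using assms by (auto simp: fun_eq_iff)
  then have ne: "\<alpha> (j, 1) \<noteq> \<beta> (j, 1) \<or> \<alpha> (j, 2) \<noteq> \<beta> (j, 2)" using exhaust_2[of i] by auto
  have rescale: "\<exists>T. \<forall>\<gamma> x. zmono \<gamma> (T x) = (a ^ \<gamma> (j, 1) * cnj a ^ \<gamma> (j, 2)) * zmono \<gamma> x" for a
  proof -
    define T :: "real ^ ('n \<times> 2) \<Rightarrow> real ^ ('n \<times> 2)" where
      "T x = (\<chi> u. if fst u = j then if snd u = 1 then Re (a * zcoord (j, 1) x)
        else Im (a * zcoord (j, 1) x) else x $ u)" for x
    define m where "m u = (if fst u = j then if snd u = 1 then a else cnj a else 1)" for u :: "'n \<times> 2"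
    have "zcoord u (T x) = m u * zcoord u x" for u x
      by (auto simp: zcoord_def T_def m_def complex_eq_iff)
    then have "zmono \<gamma> (T x) = (\<Prod>u\<in>UNIV. m u ^ \<gamma> u) * zmono \<gamma> x" for \<gamma> x
      by (rule zmono_eigen)
    moreover have "(\<Prod>u\<in>UNIV. m u ^ \<gamma> u) = a ^ \<gamma> (j, 1) * cnj a ^ \<gamma> (j, 2)" for \<gamma>
    proof -
      have "(\<Prod>u\<in>UNIV. m u ^ \<gamma> u) =
          (\<Prod>i\<in>UNIV. if i = j then a ^ \<gamma> (j, 1) * cnj a ^ \<gamma> (j, 2) else 1)"
        unfolding prod_pair_2 by (intro prod.cong) (auto simp: m_def)
      then show ?thesis by simp
    qed
    ultimately show ?thesis by auto
  qed
  have separated: ?thesis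
    if "a ^ \<alpha> (j, 1) * cnj a ^ \<alpha> (j, 2) \<noteq> a ^ \<beta> (j, 1) * cnj a ^ \<beta> (j, 2)" for a
  proof -
    obtain T where "\<forall>\<gamma> x. zmono \<gamma> (T x) = (a ^ \<gamma> (j, 1) * cnj a ^ \<gamma> (j, 2)) * zmono \<gamma> x"
      using rescale[of a] by blast
    then show ?thesis
      using that by (intro exI[of _ T] exI[of _ "\<lambda>\<gamma>. a ^ \<gamma> (j, 1) * cnj a ^ \<gamma> (j, 2)"]) blast
  qed
  show ?thesis
  proof (cases "\<alpha> (j, 1) + \<alpha> (j, 2) = \<beta> (j, 1) + \<beta> (j, 2)")
    case False
    then have "(2::complex) ^ \<alpha> (j, 1) * cnj 2 ^ \<alpha> (j, 2) \<noteq> 2 ^ \<beta> (j, 1) * cnj 2 ^ \<beta> (j, 2)"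
    proof -
      have "(2::complex) ^ k \<noteq> 2 ^ l" if "k \<noteq> l" for k l
      proof
        assume "(2::complex) ^ k = 2 ^ l"
        then have "norm ((2::complex) ^ k) = norm ((2::complex) ^ l)" by simp
        then have "(2::real) ^ k = 2 ^ l" by (simp only: norm_power norm_numeral)
        then show False using that by simp
      qed
      from this[OF False] show ?thesis by (simp add: power_add)
    qed
    then show ?thesis by (rule separated)
  next
    case True
    \<comment> \<open>The block degrees being equal, \<open>d\<close> is the difference of the two
      values of \<open>\<gamma> (j, 1) - \<gamma> (j, 2)\<close>. For
      \<open>a = cis (pi / d)\<close> the eigenvalues differ by the factor
      \<open>cis pi = -1\<close>.\<close>
    define d where "d = 2 * (real (\<alpha> (j, 1)) - real (\<beta> (j, 1)))"
    have d: "d \<noteq> 0" using ne True unfolding d_def by auto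
    have pw: "cis t ^ k * cnj (cis t) ^ l = cis (t * (real k - real l))" for t k l
      by (simp add: cis_cnj Complex.DeMoivre cis_mult algebra_simps)
    have "real (\<alpha> (j, 1)) - real (\<alpha> (j, 2)) = d + (real (\<beta> (j, 1)) - real (\<beta> (j, 2)))"
      using arg_cong[OF True, of real] unfolding d_def by simp
    then have "cis (pi / d * (real (\<alpha> (j, 1)) - real (\<alpha> (j, 2)))) =
        cis pi * cis (pi / d * (real (\<beta> (j, 1)) - real (\<beta> (j, 2))))"
      using d by (simp add: cis_mult distrib_left del: cis_pi)
    then have "cis (pi / d) ^ \<alpha> (j, 1) * cnj (cis (pi / d)) ^ \<alpha> (j, 2)
        \<noteq> cis (pi / d) ^ \<beta> (j, 1) * cnj (cis (pi / d)) ^ \<beta> (j, 2)"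
      unfolding pw by simp
    then show ?thesis by (rule separated)
  qed
qed

text \<open>Distinct monomials are eigenvectors with distinct eigenvalues of a suitable rescaling of the
  coordinates.\<close>

lemma zmono_independent:
  assumes "finite S" "\<And>x. (\<Sum>\<alpha>\<in>S. c \<alpha> * zmono \<alpha> x) = 0" "\<beta> \<in> S"
  shows "c \<beta> = 0"
  using assms
proof (induction S arbitrary: c rule: finite_psubset_induct)
  case (psubset S)
  show ?case
  proof (cases "S = {\<beta>}")
    case True
    \<comment> \<open>At this point all complex coordinates, hence all monomials, have the value
      1.\<close>
    have "zcoord u (\<chi> v. if snd v = 1 then 1 else 0) = 1" for u :: "'a \<times> 2"
      by (simp add: zcoord_def complex_eq_iff)
    then have "zmono \<beta> (\<chi> v. if snd v = 1 then 1 else 0) = 1" by (simp add: zmono_def)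
    then show ?thesis using psubset.prems(1)[of "\<chi> v. if snd v = 1 then 1 else 0"] True by simp
  next
    case False
    then obtain \<alpha> where \<alpha>: "\<alpha> \<in> S" "\<beta> \<noteq> \<alpha>" using psubset.prems by auto
    then obtain T e where T: "\<And>\<gamma> x. zmono \<gamma> (T x) = e \<gamma> * zmono \<gamma> x" "e \<beta> \<noteq> e \<alpha>"
      using zmono_separate[OF \<alpha>(2)] by blast
    \<comment> \<open>Subtracting \<open>e \<alpha>\<close> times the relation from its pullback
      along \<open>T\<close> removes the term of \<alpha> and multiplies the coefficient of \<beta>
      by the nonzero number \<open>e \<beta> - e \<alpha>\<close>.\<close>
    have "(\<Sum>\<gamma>\<in>S - {\<alpha>}. (c \<gamma> * (e \<gamma> - e \<alpha>)) * zmono \<gamma> x) = 0" for x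
    proof -
      have "(\<Sum>\<gamma>\<in>S - {\<alpha>}. (c \<gamma> * (e \<gamma> - e \<alpha>)) * zmono \<gamma> x)
          = (\<Sum>\<gamma>\<in>S. (c \<gamma> * (e \<gamma> - e \<alpha>)) * zmono \<gamma> x)"
        using psubset.hyps by (intro sum.mono_neutral_left) auto
      also have "\<dots> = (\<Sum>\<gamma>\<in>S. c \<gamma> * zmono \<gamma> (T x)) - e \<alpha> * (\<Sum>\<gamma>\<in>S. c \<gamma> * zmono \<gamma> x)"
        by (simp add: T sum_distrib_left sum_subtractf[symmetric] algebra_simps)
      finally show ?thesis using psubset.prems(1) by simp
    qed
    then have "c \<beta> * (e \<beta> - e \<alpha>) = 0"
      using psubset.IH[of "S - {\<alpha>}" "\<lambda>\<gamma>. c \<gamma> * (e \<gamma> - e \<alpha>)"] psubset.prems \<alpha> by auto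
    then show ?thesis using T by simp
  qed
qed

section \<open>The Laplacian of a monomial\<close>

lemma zcoord_add_axis: "zcoord u (x + t *\<^sub>R axis i 1) = zcoord u x + of_real t * zcoord u (axis i 1)"
  by (simp add: zcoord_def complex_eq_iff)

text \<open>This is the product rule. Where \<open>\<alpha> u = 0\<close>, truncated subtraction
  leaves the exponent unchanged, but then the factor \<open>of_nat (\<alpha> u)\<close>
  vanishes.\<close>

lemma zmono_has_partial_deriv:
  "((\<lambda>t. zmono \<alpha> (x + t *\<^sub>R axis i 1)) has_vector_derivative
    (\<Sum>u\<in>UNIV. of_nat (\<alpha> u) * zcoord u (axis i 1) * zmono (\<alpha>(u := \<alpha> u - 1)) x)) (at 0)"
proof -
  let ?k = "\<lambda>u. zcoord u (axis i 1)"
  have "((\<lambda>t. zcoord u (x + t *\<^sub>R axis i 1) ^ \<alpha> u) has_derivative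
      (\<lambda>h. h *\<^sub>R (of_nat (\<alpha> u) * ?k u * zcoord u x ^ (\<alpha> u - 1)))) (at 0)" for u
    unfolding zcoord_add_axis
    by (rule derivative_eq_intros refl | simp add: scaleR_conv_of_real mult_ac)+
  then have "((\<lambda>t. \<Prod>u\<in>UNIV. zcoord u (x + t *\<^sub>R axis i 1) ^ \<alpha> u) has_derivative
      (\<lambda>h. \<Sum>u\<in>UNIV. h *\<^sub>R (of_nat (\<alpha> u) * ?k u * zcoord u x ^ (\<alpha> u - 1)) *
        (\<Prod>v\<in>UNIV - {u}. zcoord v (x + 0 *\<^sub>R axis i 1) ^ \<alpha> v))) (at 0)"
    by (intro has_derivative_prod)
  moreover have "h *\<^sub>R (of_nat (\<alpha> u) * ?k u * zcoord u x ^ (\<alpha> u - 1)) *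
        (\<Prod>v\<in>UNIV - {u}. zcoord v (x + 0 *\<^sub>R axis i 1) ^ \<alpha> v) =
      h *\<^sub>R (of_nat (\<alpha> u) * ?k u * zmono (\<alpha>(u := \<alpha> u - 1)) x)" for h u
  proof -
    have "zmono (\<alpha>(u := \<alpha> u - 1)) x =
        zcoord u x ^ (\<alpha> u - 1) * (\<Prod>v\<in>UNIV - {u}. zcoord v x ^ \<alpha> v)"
      unfolding zmono_def by (subst prod.remove[of _ u]) (auto intro!: prod.cong)
    then show ?thesis by (simp add: mult_ac)
  qed
  ultimately show ?thesis
    unfolding has_vector_derivative_def zmono_def[symmetric] scaleR_sum_right by (simp only:)
qed

text \<open>The exponents form a family \<open>\<alpha> a\<close> because a derivative, written out,
  may repeat a monomial; in this form it can be differentiated again.\<close>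

lemma partial_deriv_zmono_sum:
  "partial_deriv i (\<lambda>x. \<Sum>a\<in>A. c a * zmono (\<alpha> a) x) x =
    (\<Sum>a\<in>A. c a * (\<Sum>u\<in>UNIV. of_nat (\<alpha> a u) * zcoord u (axis i 1) *
      zmono ((\<alpha> a)(u := \<alpha> a u - 1)) x))"
  unfolding partial_deriv_def
  by (intro vector_derivative_at has_vector_derivative_sum has_vector_derivative_mult_right
      zmono_has_partial_deriv)

lemma partial_deriv_zmono:
  "partial_deriv i (zmono \<alpha>) x =
    (\<Sum>u\<in>UNIV. of_nat (\<alpha> u) * zcoord u (axis i 1) * zmono (\<alpha>(u := \<alpha> u - 1)) x)"
  unfolding partial_deriv_def by (intro vector_derivative_at zmono_has_partial_deriv)

lemma partial_deriv_zmono_sum_eq: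
  "partial_deriv i (\<lambda>x. \<Sum>a\<in>A. c a * zmono (\<alpha> a) x) x =
    (\<Sum>a\<in>A. c a * partial_deriv i (zmono (\<alpha> a)) x)"
  by (simp add: partial_deriv_zmono_sum partial_deriv_zmono)

text \<open>Division by \<open>z_j w_j\<close> when both exponents of block \<open>j\<close> are
  positive.\<close>

definition lower :: "'n \<Rightarrow> ('n \<times> 2 \<Rightarrow> nat) \<Rightarrow> 'n \<times> 2 \<Rightarrow> nat" where
  "lower j \<alpha> u = (if fst u = j then \<alpha> u - 1 else \<alpha> u)"

text \<open>Multiplication by \<open>z_j w_j\<close>.\<close>

definition raise :: "'n \<Rightarrow> ('n \<times> 2 \<Rightarrow> nat) \<Rightarrow> 'n \<times> 2 \<Rightarrow> nat" where
  "raise j \<alpha> u = (if fst u = j then \<alpha> u + 1 else \<alpha> u)"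

lemma partial_deriv_partial_deriv_zmono_sum:
  "partial_deriv i (partial_deriv i (\<lambda>x. \<Sum>a\<in>A. c a * zmono (\<alpha> a) x)) x =
    (\<Sum>a\<in>A. c a * partial_deriv i (partial_deriv i (zmono (\<alpha> a))) x)"
proof -
  let ?b = "\<lambda>a u. of_nat (\<alpha> a u) * zcoord u (axis i 1)"
  have 1: "partial_deriv i (\<lambda>x. \<Sum>a\<in>A. c a * zmono (\<alpha> a) x) =
    (\<lambda>x. \<Sum>p\<in>A \<times> UNIV. (c (fst p) * ?b (fst p) (snd p)) *
      zmono ((\<alpha> (fst p))(snd p := \<alpha> (fst p) (snd p) - 1)) x)"
    by (auto simp: fun_eq_iff partial_deriv_zmono_sum sum_distrib_left sum.cartesian_product
        case_prod_beta mult_ac intro!: sum.cong)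
  have 2: "partial_deriv i (zmono (\<alpha> a)) =
    (\<lambda>x. \<Sum>u\<in>UNIV. ?b a u * zmono ((\<alpha> a)(u := \<alpha> a u - 1)) x)" for a
    by (simp add: fun_eq_iff partial_deriv_zmono)
  show ?thesis
    unfolding 1 2 partial_deriv_zmono_sum_eq
    by (simp add: sum_distrib_left sum.cartesian_product case_prod_beta mult_ac)
qed

lemma laplacian_zmono_sum:
  "laplacian (\<lambda>x. \<Sum>a\<in>A. c a * zmono (\<alpha> a) x) x = (\<Sum>a\<in>A. c a * laplacian (zmono (\<alpha> a)) x)"
  unfolding laplacian_def partial_deriv_partial_deriv_zmono_sum
  by (subst sum.swap) (simp add: sum_distrib_left)

text \<open>In complex coordinates the Laplacian is \<open>4 (\<partial>\<^sup>2/\<partial>z\<^sub>1\<partial>w\<^sub>1 + \<dots> + \<partial>\<^sup>2/\<partial>z\<^sub>n\<partial>w\<^sub>n)\<close>.\<close>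

lemma laplacian_zmono:
  "laplacian (zmono \<alpha>) x =
    4 * (\<Sum>j\<in>UNIV. of_nat (\<alpha> (j, 1) * \<alpha> (j, 2)) * zmono (lower j \<alpha>) x)"
proof -
  let ?k = "\<lambda>u i. zcoord u (axis i 1)"
  let ?b = "\<lambda>u. \<alpha>(u := \<alpha> u - 1)"
  let ?g = "\<lambda>u v. (?b u)(v := ?b u v - 1)"
  have pd: "partial_deriv i (zmono \<alpha>) = (\<lambda>x. \<Sum>u\<in>UNIV. (of_nat (\<alpha> u) * ?k u i) * zmono (?b u) x)" for i
    by (simp add: fun_eq_iff partial_deriv_zmono)
  \<comment> \<open>The bilinear, not Hermitian, product of two gradients:
    \<open>1 + i^2 = 0\<close> for \<open>z_j\<close> or \<open>w_j\<close> with itself,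
    \<open>1 - i^2 = 2\<close> for \<open>z_j\<close> with \<open>w_j\<close>.\<close>
  have kk: "(\<Sum>i\<in>UNIV. ?k u i * ?k v i) = (if fst u = fst v \<and> snd u \<noteq> snd v then 2 else 0)"
    for u v :: "'a \<times> 2"
  proof -
    have k: "?k u (j, 1) = (if j = fst u then 1 else 0)"
      "?k u (j, 2) = (if j = fst u then if snd u = 1 then \<i> else - \<i> else 0)" for u :: "'a \<times> 2" and j
      by (auto simp: zcoord_def axis_def complex_eq_iff)
    have "(\<Sum>i\<in>UNIV. ?k u i * ?k v i) = (\<Sum>j\<in>UNIV. if j = fst u then
        if fst u = fst v \<and> snd u \<noteq> snd v then 2 else 0 else 0)"
      unfolding sum_pair_2 k using exhaust_2[of "snd u"] exhaust_2[of "snd v"]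
      by (intro sum.cong) auto
    then show ?thesis by simp
  qed
  have "laplacian (zmono \<alpha>) x = (\<Sum>i\<in>UNIV. \<Sum>u\<in>UNIV. \<Sum>v\<in>UNIV.
      of_nat (\<alpha> u) * of_nat (?b u v) * (?k u i * ?k v i) * zmono (?g u v) x)"
    unfolding laplacian_def pd partial_deriv_zmono_sum by (simp add: sum_distrib_left mult_ac)
  also have "\<dots> = (\<Sum>u\<in>UNIV. \<Sum>v\<in>UNIV. \<Sum>i\<in>UNIV.
      of_nat (\<alpha> u) * of_nat (?b u v) * (?k u i * ?k v i) * zmono (?g u v) x)"
    by (subst sum.swap, rule sum.cong[OF refl], rule sum.swap)
  also have "\<dots> = (\<Sum>u\<in>UNIV. \<Sum>v\<in>UNIV.
      of_nat (\<alpha> u) * of_nat (?b u v) * (\<Sum>i\<in>UNIV. ?k u i * ?k v i) * zmono (?g u v) x)"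
    by (simp add: sum_distrib_left sum_distrib_right)
  \<comment> \<open>Differentiating by \<open>z_j\<close> first or by \<open>w_j\<close> first
    contributes 2 each, hence the factor 4.\<close>
  also have "\<dots> = (\<Sum>j\<in>UNIV. \<Sum>l\<in>UNIV. if l = j then
      4 * (of_nat (\<alpha> (j, 1) * \<alpha> (j, 2)) * zmono (lower j \<alpha>) x) else 0)"
  proof -
    have g: "?g (j, 1) (j, 2) = lower j \<alpha>" "?g (j, 2) (j, 1) = lower j \<alpha>" for j
      using exhaust_2 by (auto simp: lower_def fun_eq_iff)
    have ne: "(1::2) \<noteq> 2" "(2::2) \<noteq> 1" by auto
    show ?thesis
      unfolding kk
      unfolding sum_pair_2 sum.distrib[symmetric]
      by (intro sum.cong refl) (auto simp: g[simplified] ne)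
  qed
  also have "\<dots> = 4 * (\<Sum>j\<in>UNIV. of_nat (\<alpha> (j, 1) * \<alpha> (j, 2)) * zmono (lower j \<alpha>) x)"
    by (simp add: sum_distrib_left)
  finally show ?thesis .
qed

section \<open>The action of the lens group\<close>

text \<open>With arbitrary angles, composition is addition of angles, and the rotation by half the
  angles is available for the determinant.\<close>

definition rot :: "('n::finite \<Rightarrow> real) \<Rightarrow> real ^ ('n \<times> 2) ^ ('n \<times> 2)" where
  "rot \<phi> = (\<chi> u v. if fst u \<noteq> fst v then 0 else if snd u = snd v then cos (\<phi> (fst u))
     else if snd u = 1 then sin (\<phi> (fst u)) else - sin (\<phi> (fst u)))"

lemma lens_matrix_eq_rot: "lens_matrix q s = rot (\<lambda>j. 2 * pi * of_int (s $ j) / of_nat q)"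
proof -
  have "lens_matrix q s $ u $ v = rot (\<lambda>j. 2 * pi * of_int (s $ j) / of_nat q) $ u $ v" for u v
    using exhaust_2[of "snd u"] exhaust_2[of "snd v"]
    by (auto simp: lens_matrix_def rot_def Let_def)
  then show ?thesis by (simp add: vec_eq_iff)
qed

lemma rot_apply:
  "(rot \<phi> *v x) $ (j, 1) = cos (\<phi> j) * x $ (j, 1) + sin (\<phi> j) * x $ (j, 2)"
  "(rot \<phi> *v x) $ (j, 2) = cos (\<phi> j) * x $ (j, 2) - sin (\<phi> j) * x $ (j, 1)"
proof -
  have "(rot \<phi> *v x) $ (j, i) = (\<Sum>l\<in>UNIV. if l = j then
      rot \<phi> $ (j, i) $ (j, 1) * x $ (j, 1) + rot \<phi> $ (j, i) $ (j, 2) * x $ (j, 2) else 0)" for i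
    unfolding matrix_vector_mult_def vec_lambda_beta sum_pair_2
    by (intro sum.cong) (auto simp: rot_def)
  then show "(rot \<phi> *v x) $ (j, 1) = cos (\<phi> j) * x $ (j, 1) + sin (\<phi> j) * x $ (j, 2)"
    "(rot \<phi> *v x) $ (j, 2) = cos (\<phi> j) * x $ (j, 2) - sin (\<phi> j) * x $ (j, 1)"
    by (simp_all add: rot_def)
qed

lemma vec_eq_pair_2: "x = y \<longleftrightarrow> (\<forall>j. x $ (j, 1) = y $ (j, 1) \<and> x $ (j, 2) = y $ (j, 2 :: 2))"
proof
  assume eq: "\<forall>j. x $ (j, 1) = y $ (j, 1) \<and> x $ (j, 2) = y $ (j, 2)"
  have "x $ u = y $ u" for u
    using eq exhaust_2[of "snd u"] by (cases u) auto
  then show "x = y" by (simp add: vec_eq_iff)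
qed simp

lemma rot_mult: "rot \<phi> ** rot \<psi> = rot (\<lambda>j. \<phi> j + \<psi> j)"
  unfolding matrix_eq matrix_vector_mul_assoc[symmetric] vec_eq_pair_2 rot_apply
  by (simp add: cos_add sin_add algebra_simps)

lemma rot_0: "rot (\<lambda>j. 0) = mat 1"
  unfolding matrix_eq vec_eq_pair_2 rot_apply by simp

lemma transpose_rot: "transpose (rot \<phi>) = rot (\<lambda>j. - \<phi> j)"
proof -
  have "transpose (rot \<phi>) $ u $ v = rot (\<lambda>j. - \<phi> j) $ u $ v" for u v
    using exhaust_2[of "snd u"] exhaust_2[of "snd v"] by (auto simp: transpose_def rot_def)
  then show ?thesis by (simp add: vec_eq_iff)
qed

lemma orthogonal_matrix_rot: "orthogonal_matrix (rot \<phi>)"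
  by (simp add: orthogonal_matrix_def transpose_rot rot_mult rot_0)

text \<open>A rotation is the square of an orthogonal matrix, namely of the rotation by half the angles.\<close>

lemma det_rot: "det (rot \<phi>) = 1"
proof -
  have "rot \<phi> = rot (\<lambda>j. \<phi> j / 2) ** rot (\<lambda>j. \<phi> j / 2)" by (simp add: rot_mult)
  then have "det (rot \<phi>) = det (rot (\<lambda>j. \<phi> j / 2)) * det (rot (\<lambda>j. \<phi> j / 2))"
    by (simp only: det_mul)
  then show ?thesis
    using det_orthogonal_matrix[OF orthogonal_matrix_rot[of "\<lambda>j. \<phi> j / 2"]] by auto
qed

lemma group_SO_group: "group SO_group"
proof (rule groupI)
  fix A :: "real ^ 'm ^ 'm" assume "A \<in> carrier SO_group"
  then show "\<exists>B\<in>carrier SO_group. B \<otimes>\<^bsub>SO_group\<^esub> A = \<one>\<^bsub>SO_group\<^esub>"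
    by (intro bexI[of _ "transpose A"])
      (auto simp: SO_group_def orthogonal_matrix_def det_transpose)
qed (auto simp: SO_group_def orthogonal_matrix_mul det_mul matrix_mul_assoc orthogonal_matrix_id)

lemma matrix_inv_SO:
  assumes "A \<in> carrier SO_group"
  shows "matrix_inv A ** A = mat 1" "A ** matrix_inv A = mat 1"
proof -
  have "invertible A"
    using assms unfolding invertible_def by (auto simp: SO_group_def orthogonal_matrix_def)
  then show "matrix_inv A ** A = mat 1" "A ** matrix_inv A = mat 1"
    unfolding invertible_def matrix_inv_def by (metis (mono_tags, lifting) someI_ex)+
qed

text \<open>\<open>act\<close> inverts the matrix, but substituting \<open>R *v x\<close> for
  \<open>x\<close> removes the inverse; invariance then passes to inverses and products.\<close>

lemma generate_SO_invariant_iff: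
  assumes R: "R \<in> carrier SO_group"
  shows "(\<forall>g\<in>generate SO_group {R}. act g f = f) \<longleftrightarrow> (\<forall>x. f (R *v x) = f x)"
proof
  assume "\<forall>g\<in>generate SO_group {R}. act g f = f"
  then have "act R f = f" by (simp add: generate.incl)
  then have "f (matrix_inv R *v (R *v x)) = f (R *v x)" for x
    unfolding act_def by metis
  then show "\<forall>x. f (R *v x) = f x"
    by (simp add: matrix_vector_mul_assoc matrix_inv_SO[OF R])
next
  assume f: "\<forall>x. f (R *v x) = f x"
  interpret SO: group SO_group by (rule group_SO_group)
  have mult: "A \<otimes>\<^bsub>SO_group\<^esub> B = A ** B" "\<one>\<^bsub>SO_group\<^esub> = mat 1" for A B :: "real ^ 'a ^ 'a"
    by (simp_all add: SO_group_def)
  \<comment> \<open>Membership in the carrier is carried along because cancelling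
    \<open>matrix_inv g\<close> below relies on it.\<close>
  have gen: "\<forall>x. f (g *v x) = f x" "g \<in> carrier SO_group" if "g \<in> generate SO_group {R}" for g
    using that
  proof (induction rule: generate.induct)
    case (inv h)
    have "R ** inv\<^bsub>SO_group\<^esub> R = mat 1" using SO.r_inv[OF R] by (simp add: mult)
    then have "f (R *v (inv\<^bsub>SO_group\<^esub> R *v x)) = f x" for x
      by (simp add: matrix_vector_mul_assoc)
    then show "\<forall>x. f (inv\<^bsub>SO_group\<^esub> h *v x) = f x" using f inv by simp
    show "inv\<^bsub>SO_group\<^esub> h \<in> carrier SO_group" using inv R by simp
  next
    case (eng h1 h2)
    then show "\<forall>x. f (h1 \<otimes>\<^bsub>SO_group\<^esub> h2 *v x) = f x"
      by (simp add: mult matrix_vector_mul_assoc[symmetric])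
    show "h1 \<otimes>\<^bsub>SO_group\<^esub> h2 \<in> carrier SO_group" using eng by (intro SO.m_closed)
  next
    case one
    show "\<forall>x. f (\<one>\<^bsub>SO_group\<^esub> *v x) = f x" by (simp add: mult)
    show "\<one>\<^bsub>SO_group\<^esub> \<in> carrier SO_group" by (rule SO.one_closed)
  qed (use R f in auto)
  show "\<forall>g\<in>generate SO_group {R}. act g f = f"
  proof
    fix g assume g: "g \<in> generate SO_group {R}"
    have "f (matrix_inv g *v x) = f (g *v (matrix_inv g *v x))" for x using gen(1)[OF g] by simp
    also have "\<dots> x = f x" for x
      by (simp add: matrix_vector_mul_assoc matrix_inv_SO[OF gen(2)[OF g]])
    finally show "act g f = f" by (simp add: act_def fun_eq_iff)
  qed
qed

text \<open>The weight of a monomial under the torus of block rotations: \<open>a - b\<close> for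
  \<open>z^a w^b\<close>.\<close>

definition weight :: "('n \<times> 2 \<Rightarrow> nat) \<Rightarrow> int ^ 'n" where
  "weight \<alpha> = (\<chi> j. int (\<alpha> (j, 1)) - int (\<alpha> (j, 2)))"

lemma prod_cis: "(\<Prod>i\<in>A. cis (f i)) = cis (\<Sum>i\<in>A. f i)"
  by (induction A rule: infinite_finite_induct) (auto simp: cis_mult)

text \<open>Block \<open>j\<close> turns \<open>z_j\<close> by \<open>- \<phi> j\<close> and
  \<open>w_j\<close> by \<open>\<phi> j\<close>, so only the difference of their exponents enters
  the scalar.\<close>

lemma zmono_rot:
  "zmono \<alpha> (rot \<phi> *v x) = cis (- (\<Sum>j\<in>UNIV. \<phi> j * of_int (weight \<alpha> $ j))) * zmono \<alpha> x"
proof -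
  let ?m = "\<lambda>u. cis (if snd u = 1 then - \<phi> (fst u) else \<phi> (fst u))"
  have "zcoord u (rot \<phi> *v x) = ?m u * zcoord u x" for u
    by (simp add: zcoord_def rot_apply complex_eq_iff algebra_simps)
  then have "zmono \<alpha> (rot \<phi> *v x) = (\<Prod>u\<in>UNIV. ?m u ^ \<alpha> u) * zmono \<alpha> x"
    by (rule zmono_eigen)
  also have "(\<Prod>u\<in>UNIV. ?m u ^ \<alpha> u) = (\<Prod>j\<in>UNIV. cis (- (\<phi> j * of_int (weight \<alpha> $ j))))"
    unfolding prod_pair_2
    by (intro prod.cong) (auto simp: Complex.DeMoivre cis_mult weight_def algebra_simps)
  finally show ?thesis by (simp add: prod_cis sum_negf)
qed

text \<open>The eigenvalue is \<open>cis (- 2 * pi * m / q)\<close>, where \<open>m\<close> is the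
  pairing of the weight with \<open>s\<close>; it equals 1 iff \<open>q\<close> divides
  \<open>m\<close>.\<close>

lemma zmono_lens_matrix_eq_iff:
  assumes "q \<ge> 1"
  shows "\<exists>e. (\<forall>x. zmono \<alpha> (lens_matrix q s *v x) = e * zmono \<alpha> x) \<and>
    (e = 1 \<longleftrightarrow> weight \<alpha> \<in> congruence_lattice q s)"
proof -
  define m where "m = (\<Sum>j\<in>UNIV. weight \<alpha> $ j * s $ j)"
  define t where "t = 2 * pi * of_int m / of_nat q"
  have "(\<Sum>j\<in>UNIV. 2 * pi * of_int (s $ j) / of_nat q * of_int (weight \<alpha> $ j)) = t"
    unfolding t_def m_def by (simp add: sum_distrib_left sum_divide_distrib mult_ac)
  then have 1: "zmono \<alpha> (lens_matrix q s *v x) = cis (- t) * zmono \<alpha> x" for x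
    unfolding lens_matrix_eq_rot zmono_rot by simp
  have "cis (- t) = 1 \<longleftrightarrow> (\<exists>n. - t = of_int n * (2 * pi))" by (rule cis_eq_1_iff)
  also have "\<dots> \<longleftrightarrow> (\<exists>n. m = int q * n)"
  proof -
    have "- t = of_int n * (2 * pi) \<longleftrightarrow> m = int q * (- n)" for n
    proof -
      have "- t = of_int n * (2 * pi) \<longleftrightarrow> pi * of_int m = pi * real_of_int (int q * (- n))"
        using assms unfolding t_def by (auto simp: field_simps)
      then show ?thesis by (simp only: mult_cancel_left pi_neq_zero simp_thms of_int_eq_iff)
    qed
    then show ?thesis by (metis minus_minus)
  qed
  also have "\<dots> \<longleftrightarrow> weight \<alpha> \<in> congruence_lattice q s"
    by (simp add: congruence_lattice_def cong_0_iff dvd_def m_def)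
  finally show ?thesis using 1 by blast
qed

section \<open>Harmonic coefficients\<close>

text \<open>Extends values prescribed at the exponents not divisible by \<open>z\<^sub>k w\<^sub>k\<close>, by solving the relation
  in \<open>harmonic_coeffs\<close> below for its term with index \<open>k\<close>.\<close>

function kernel_ext :: "'n::finite \<Rightarrow> (('n \<times> 2 \<Rightarrow> nat) \<Rightarrow> complex) \<Rightarrow> ('n \<times> 2 \<Rightarrow> nat) \<Rightarrow> complex" where
  "kernel_ext k g \<alpha> = (if \<alpha> (k, 1) = 0 \<or> \<alpha> (k, 2) = 0 then g \<alpha> else
     - (\<Sum>j\<in>UNIV - {k}. of_nat (raise j (lower k \<alpha>) (j, 1) * raise j (lower k \<alpha>) (j, 2)) *
         kernel_ext k g (raise j (lower k \<alpha>))) / of_nat (\<alpha> (k, 1) * \<alpha> (k, 2)))"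
  by pat_completeness auto
text \<open>Each recursive call trades a factor \<open>z_k w_k\<close> for some
  \<open>z_j w_j\<close> with \<open>j \<noteq> k\<close>, so the exponent of \<open>z_k\<close>
  drops by one.\<close>

termination
  by (relation "Wellfounded.measure (\<lambda>(k, g, \<alpha>). \<alpha> (k, 1))") (auto simp: raise_def lower_def)

text \<open>As a rewrite rule, the unguarded recursive equation could be unfolded forever.\<close>

declare kernel_ext.simps [simp del]

lemma raise_lower: "\<alpha> (j, 1) > 0 \<Longrightarrow> \<alpha> (j, 2) > 0 \<Longrightarrow> raise j (lower j \<alpha>) = \<alpha>"
proof
  fix u assume "\<alpha> (j, 1) > 0" "\<alpha> (j, 2) > 0"
  then show "raise j (lower j \<alpha>) u = \<alpha> u"
    using exhaust_2[of "snd u"] by (cases u) (auto simp: raise_def lower_def)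
qed

lemma lower_raise: "lower j (raise j \<alpha>) = \<alpha>"
  by (auto simp: fun_eq_iff raise_def lower_def)

text \<open>Up to the factor 4, the sum at \<beta> is the coefficient of
  \<open>zmono \<beta>\<close> in the Laplacian. When \<open>S\<close> lies in a single degree, the
  support condition settles every \<beta> not two degrees below.\<close>

definition harmonic_coeffs :: "('n::finite \<times> 2 \<Rightarrow> nat) set \<Rightarrow> (('n \<times> 2 \<Rightarrow> nat) \<Rightarrow> complex) set" where
  "harmonic_coeffs S = {c. (\<forall>\<alpha>. \<alpha> \<notin> S \<longrightarrow> c \<alpha> = 0) \<and>
     (\<forall>\<beta>. (\<Sum>j\<in>UNIV. of_nat (raise j \<beta> (j, 1) * raise j \<beta> (j, 2)) * c (raise j \<beta>)) = 0)}"

text \<open>The recursion only trades one factor \<open>z_i w_i\<close> for another, and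
  \<open>S\<close> is closed under such trades; started outside \<open>S\<close>, it stays
  outside.\<close>

lemma kernel_ext_outside:
  assumes S: "\<And>i j \<beta>. raise i \<beta> \<in> S \<Longrightarrow> raise j \<beta> \<in> S"
    and g: "\<And>\<alpha>. \<alpha> \<notin> S \<Longrightarrow> g \<alpha> = 0"
  shows "\<alpha> \<notin> S \<Longrightarrow> kernel_ext k g \<alpha> = 0"
proof (induction "\<alpha> (k, 1)" arbitrary: \<alpha> rule: less_induct)
  case less
  show ?case
  proof (cases "\<alpha> (k, 1) = 0 \<or> \<alpha> (k, 2) = 0")
    case True
    then show ?thesis using g less.prems by (subst kernel_ext.simps) auto
  next
    case False
    then have "raise k (lower k \<alpha>) \<notin> S" using less.prems by (simp add: raise_lower)
    then have "kernel_ext k g (raise j (lower k \<alpha>)) = 0" if "j \<noteq> k" for j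
      using that False S by (intro less.hyps) (auto simp: raise_def lower_def)
    then show ?thesis using False by (subst kernel_ext.simps) simp
  qed
qed

text \<open>The relation at \<beta> is the recursion equation at \<open>raise k \<beta>\<close>,
  cleared of its denominator.\<close>

lemma kernel_ext_harmonic:
  assumes S: "\<And>i j \<beta>. raise i \<beta> \<in> S \<Longrightarrow> raise j \<beta> \<in> S"
    and g: "\<And>\<alpha>. \<alpha> \<notin> S \<Longrightarrow> g \<alpha> = 0"
  shows "kernel_ext k g \<in> harmonic_coeffs S"
proof -
  have "(\<Sum>j\<in>UNIV. of_nat (raise j \<beta> (j, 1) * raise j \<beta> (j, 2)) * kernel_ext k g (raise j \<beta>)) = 0" for \<beta>
  proof -
    have "of_nat (raise k \<beta> (k, 1) * raise k \<beta> (k, 2)) * kernel_ext k g (raise k \<beta>) =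
       - (\<Sum>j\<in>UNIV - {k}. of_nat (raise j \<beta> (j, 1) * raise j \<beta> (j, 2)) * kernel_ext k g (raise j \<beta>))"
    proof -
      have pos: "raise k \<beta> (k, 1) \<noteq> 0" "raise k \<beta> (k, 2) \<noteq> 0" by (simp_all add: raise_def)
      then show ?thesis
        by (subst kernel_ext.simps) (simp add: lower_raise)
    qed
    then show ?thesis by (subst sum.remove[of _ k]) auto
  qed
  then show ?thesis
    unfolding harmonic_coeffs_def using kernel_ext_outside[OF S g] by simp
qed

lemma kernel_ext_eq: "\<alpha> (k, 1) = 0 \<or> \<alpha> (k, 2) = 0 \<Longrightarrow> kernel_ext k g \<alpha> = g \<alpha>"
  by (subst kernel_ext.simps) auto

text \<open>In the relation at \<open>lower k \<alpha>\<close>, every term but that of \<alpha>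
  belongs to a smaller exponent of \<open>z_k\<close>, and the term of \<alpha> has a nonzero
  factor. So induction on that exponent applies.\<close>

lemma harmonic_coeffs_eq_0:
  assumes c: "c \<in> harmonic_coeffs S"
    and 0: "\<And>\<alpha>. \<alpha> \<in> S \<Longrightarrow> \<alpha> (k, 1) = 0 \<or> \<alpha> (k, 2) = 0 \<Longrightarrow> c \<alpha> = 0"
  shows "c \<alpha> = 0"
proof (induction "\<alpha> (k, 1)" arbitrary: \<alpha> rule: less_induct)
  case less
  show ?case
  proof (cases "\<alpha> (k, 1) = 0 \<or> \<alpha> (k, 2) = 0")
    case True
    then show ?thesis using 0 c unfolding harmonic_coeffs_def by blast
  next
    case False
    define \<beta> where "\<beta> = lower k \<alpha>"
    have \<alpha>: "raise k \<beta> = \<alpha>" using False by (simp add: \<beta>_def raise_lower)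
    have "c (raise j \<beta>) = 0" if "j \<noteq> k" for j
      using that False by (intro less) (auto simp: raise_def lower_def \<beta>_def)
    moreover have "(\<Sum>j\<in>UNIV. of_nat (raise j \<beta> (j, 1) * raise j \<beta> (j, 2)) * c (raise j \<beta>)) = 0"
      using c unfolding harmonic_coeffs_def by blast
    ultimately have "of_nat (\<alpha> (k, 1) * \<alpha> (k, 2)) * c \<alpha> = 0"
      by (subst (asm) sum.remove[of _ k]) (auto simp: \<alpha>)
    then show ?thesis using False by simp
  qed
qed

lemma harmonic_coeffs_diff_sum:
  assumes "c \<in> harmonic_coeffs S" "\<And>b. b \<in> B \<Longrightarrow> d b \<in> harmonic_coeffs S"
  shows "(\<lambda>\<alpha>. c \<alpha> - (\<Sum>b\<in>B. t b * d b \<alpha>)) \<in> harmonic_coeffs S"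
proof -
  have "(\<Sum>j\<in>UNIV. w j * (c (r j) - (\<Sum>b\<in>B. t b * d b (r j)))) =
      (\<Sum>j\<in>UNIV. w j * c (r j)) - (\<Sum>b\<in>B. t b * (\<Sum>j\<in>UNIV. w j * d b (r j)))"
    for w :: "'a \<Rightarrow> complex" and r
    by (subst sum_distrib_left, subst sum.swap)
      (simp add: right_diff_distrib sum_subtractf sum_distrib_left mult_ac)
  then show ?thesis using assms unfolding harmonic_coeffs_def by simp
qed

text \<open>Restriction to the exponents in \<open>S\<close> not divisible by \<open>z_k w_k\<close>
  is a bijection from harmonic coefficients to arbitrary values there: \<open>kernel_ext\<close>
  extends values, and extensions are unique. The unit vectors thus extend to a basis.\<close>

lemma dim_harmonic_coeffs:
  fixes S :: "('n::finite \<times> 2 \<Rightarrow> nat) set"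
  assumes fin: "finite S"
    and S: "\<And>i j \<beta>. raise i \<beta> \<in> S \<Longrightarrow> raise j \<beta> \<in> S"
  shows "cfun.dim ((\<lambda>c x. \<Sum>\<alpha>\<in>S. c \<alpha> * zmono \<alpha> x) ` harmonic_coeffs S) =
    card {\<alpha> \<in> S. \<alpha> (k, 1) = 0 \<or> \<alpha> (k, 2) = 0}"
proof -
  define B where "B = {\<alpha> \<in> S. \<alpha> (k, 1) = 0 \<or> \<alpha> (k, 2) = 0}"
  define d where "d b = kernel_ext k (\<lambda>\<alpha>. if \<alpha> = b then 1 else 0)" for b
  define v where "v b x = (\<Sum>\<alpha>\<in>S. d b \<alpha> * zmono \<alpha> x)" for b x
  have finB: "finite B" using fin unfolding B_def by simp
  have d: "d b \<in> harmonic_coeffs S" if "b \<in> B" for b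
    using that S unfolding d_def B_def by (intro kernel_ext_harmonic) auto
  have dB: "d b \<alpha> = (if \<alpha> = b then 1 else 0)" if "\<alpha> \<in> B" for \<alpha> b
    using that unfolding d_def B_def by (subst kernel_ext_eq) auto
  have comb: "(\<Sum>b\<in>B. t b * v b x) = (\<Sum>\<alpha>\<in>S. (\<Sum>b\<in>B. t b * d b \<alpha>) * zmono \<alpha> x)" for t x
    unfolding v_def sum_distrib_left sum_distrib_right
    by (subst sum.swap) (simp add: mult_ac)
  have combB: "(\<Sum>b\<in>B. t b * d b \<alpha>) = t \<alpha>" if "\<alpha> \<in> B" for t \<alpha>
    using that finB by (simp add: dB if_distrib[of "\<lambda>x. _ * x"] cong: if_cong)
  have "cfun.dim ((\<lambda>c x. \<Sum>\<alpha>\<in>S. c \<alpha> * zmono \<alpha> x) ` harmonic_coeffs S) = card B"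
  proof (rule cfun_dim_eq_card[OF finB, of v])
    fix b assume "b \<in> B"
    then show "v b \<in> (\<lambda>c x. \<Sum>\<alpha>\<in>S. c \<alpha> * zmono \<alpha> x) ` harmonic_coeffs S"
      using d by (auto simp: v_def fun_eq_iff intro!: image_eqI[of _ _ "d b"])
  next
    fix f assume "f \<in> (\<lambda>c x. \<Sum>\<alpha>\<in>S. c \<alpha> * zmono \<alpha> x) ` harmonic_coeffs S"
    then obtain c where c: "c \<in> harmonic_coeffs S" "f = (\<lambda>x. \<Sum>\<alpha>\<in>S. c \<alpha> * zmono \<alpha> x)" by blast
    \<comment> \<open>The combination with the values of \<open>c\<close> on \<open>B\<close>
      differs from \<open>c\<close> by a harmonic family that vanishes on \<open>B\<close>, hence
      everywhere.\<close>
    have "c \<alpha> - (\<Sum>b\<in>B. c b * d b \<alpha>) = 0" for \<alpha>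
    proof (rule harmonic_coeffs_eq_0[where k = k])
      show "(\<lambda>\<alpha>. c \<alpha> - (\<Sum>b\<in>B. c b * d b \<alpha>)) \<in> harmonic_coeffs S"
        using c(1) d by (rule harmonic_coeffs_diff_sum)
    next
      fix \<alpha> assume "\<alpha> \<in> S" "\<alpha> (k, 1) = 0 \<or> \<alpha> (k, 2) = 0"
      then have "\<alpha> \<in> B" by (simp add: B_def)
      then show "c \<alpha> - (\<Sum>b\<in>B. c b * d b \<alpha>) = 0" by (simp add: combB)
    qed
    then have "(\<Sum>b\<in>B. c b * d b \<alpha>) = c \<alpha>" for \<alpha> by (metis eq_iff_diff_eq_0)
    then have "f x = (\<Sum>b\<in>B. c b * v b x)" for x unfolding comb c(2) by simp
    then show "\<exists>c. \<forall>x. f x = (\<Sum>b\<in>B. c b * v b x)" by blast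
  next
    \<comment> \<open>Compare the coefficients of \<open>zmono b\<close>, using the independence of
      the monomials.\<close>
    fix t b assume "\<And>x. (\<Sum>b\<in>B. t b * v b x) = 0" and b: "b \<in> B"
    then have "(\<Sum>a\<in>B. t a * d a b) = 0"
      unfolding comb using b zmono_independent[OF fin, of "\<lambda>\<alpha>. \<Sum>a\<in>B. t a * d a \<alpha>" b]
      by (simp add: B_def)
    then show "t b = 0" using combB[OF b] by simp
  qed
  then show ?thesis unfolding B_def .
qed

lemma sum_raise: "sum (raise j \<alpha>) UNIV = sum \<alpha> UNIV + 2"
  for \<alpha> :: "'n::finite \<times> 2 \<Rightarrow> nat"
proof -
  have "raise j \<alpha> u = \<alpha> u + (if fst u = j then 1 else 0)" for u :: "'n \<times> 2" by (simp add: raise_def)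
  then have "sum (raise j \<alpha>) UNIV = sum \<alpha> UNIV + (\<Sum>(u::'n \<times> 2)\<in>UNIV. if fst u = j then 1 else 0)"
    by (simp add: sum.distrib)
  also have "(\<Sum>(u::'n \<times> 2)\<in>UNIV. if fst u = j then 1 else 0 :: nat) = (\<Sum>i\<in>UNIV. if i = j then 2 else 0)"
    unfolding sum_pair_2 by (intro sum.cong) auto
  finally show ?thesis by simp
qed

text \<open>The mixed derivative in block \<open>j\<close> reaches the monomial of \<beta> only from
  \<open>raise j \<beta>\<close>. Writing \<open>sum \<beta> UNIV + 2 = k\<close> makes the range
  empty for \<open>k < 2\<close>, where \<open>k - 2\<close> would be truncated.\<close>

lemma laplacian_homogeneous:
  fixes c :: "('n::finite \<times> 2 \<Rightarrow> nat) \<Rightarrow> complex"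
  shows "laplacian (\<lambda>x. \<Sum>\<alpha> | sum \<alpha> UNIV = k. c \<alpha> * zmono \<alpha> x) x =
    4 * (\<Sum>\<beta> | sum \<beta> UNIV + 2 = k.
      (\<Sum>j\<in>UNIV. of_nat (raise j \<beta> (j, 1) * raise j \<beta> (j, 2)) * c (raise j \<beta>)) * zmono \<beta> x)"
proof -
  let ?S = "{\<alpha> :: 'n \<times> 2 \<Rightarrow> nat. sum \<alpha> UNIV = k}"
  let ?h = "\<lambda>j \<alpha>. of_nat (\<alpha> (j, 1) * \<alpha> (j, 2)) * c \<alpha> * zmono (lower j \<alpha>) x"
  have inner: "(\<Sum>\<alpha>\<in>?S. ?h j \<alpha>) = (\<Sum>\<beta> | sum \<beta> UNIV + 2 = k.
      of_nat (raise j \<beta> (j, 1) * raise j \<beta> (j, 2)) * c (raise j \<beta>) * zmono \<beta> x)" for j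
  proof -
    \<comment> \<open>The discarded terms have the factor 0; on the remaining exponents
      \<open>lower j\<close> inverts \<open>raise j\<close>.\<close>
    have "(\<Sum>\<alpha>\<in>?S. ?h j \<alpha>) = (\<Sum>\<alpha>\<in>{\<alpha>\<in>?S. \<alpha> (j, 1) > 0 \<and> \<alpha> (j, 2) > 0}. ?h j \<alpha>)"
      by (intro sum.mono_neutral_right finite_functions_sum_eq) auto
    also have "\<dots> = (\<Sum>\<beta> | sum \<beta> UNIV + 2 = k.
      of_nat (raise j \<beta> (j, 1) * raise j \<beta> (j, 2)) * c (raise j \<beta>) * zmono \<beta> x)"
    proof (rule sum.reindex_bij_witness[of _ "raise j" "lower j"])
      fix \<alpha> assume \<alpha>: "\<alpha> \<in> {\<alpha>\<in>?S. \<alpha> (j, 1) > 0 \<and> \<alpha> (j, 2) > 0}"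
      then show "raise j (lower j \<alpha>) = \<alpha>" by (simp add: raise_lower)
      then show "lower j \<alpha> \<in> {\<beta>. sum \<beta> UNIV + 2 = k}"
        using \<alpha> sum_raise[of j "lower j \<alpha>"] by simp
      show "of_nat (raise j (lower j \<alpha>) (j, 1) * raise j (lower j \<alpha>) (j, 2)) *
          c (raise j (lower j \<alpha>)) * zmono (lower j \<alpha>) x = ?h j \<alpha>"
        using \<alpha> by (simp add: raise_lower)
    next
      fix \<beta> :: "'n \<times> 2 \<Rightarrow> nat" assume "\<beta> \<in> {\<beta>. sum \<beta> UNIV + 2 = k}"
      then show "raise j \<beta> \<in> {\<alpha>\<in>?S. \<alpha> (j, 1) > 0 \<and> \<alpha> (j, 2) > 0}"
        by (simp add: sum_raise) (simp add: raise_def)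
    qed (simp add: lower_raise)
    finally show ?thesis .
  qed
  have "laplacian (\<lambda>x. \<Sum>\<alpha>\<in>?S. c \<alpha> * zmono \<alpha> x) x = (\<Sum>\<alpha>\<in>?S. \<Sum>j\<in>UNIV. 4 * ?h j \<alpha>)"
    by (simp add: laplacian_zmono_sum laplacian_zmono sum_distrib_left mult_ac)
  also have "\<dots> = 4 * (\<Sum>j\<in>UNIV. \<Sum>\<alpha>\<in>?S. ?h j \<alpha>)"
    by (subst sum.swap) (simp add: sum_distrib_left)
  also have "\<dots> = 4 * (\<Sum>j\<in>UNIV. \<Sum>\<beta> | sum \<beta> UNIV + 2 = k.
      of_nat (raise j \<beta> (j, 1) * raise j \<beta> (j, 2)) * c (raise j \<beta>) * zmono \<beta> x)"
    by (simp only: inner)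
  also have "\<dots> = 4 * (\<Sum>\<beta> | sum \<beta> UNIV + 2 = k. \<Sum>j\<in>UNIV.
      of_nat (raise j \<beta> (j, 1) * raise j \<beta> (j, 2)) * c (raise j \<beta>) * zmono \<beta> x)"
    by (subst sum.swap) (rule refl)
  also have "\<dots> = 4 * (\<Sum>\<beta> | sum \<beta> UNIV + 2 = k.
      (\<Sum>j\<in>UNIV. of_nat (raise j \<beta> (j, 1) * raise j \<beta> (j, 2)) * c (raise j \<beta>)) * zmono \<beta> x)"
    by (intro arg_cong[where f = "(*) 4"] sum.cong refl sum_distrib_right[symmetric])
  finally show ?thesis .
qed

section \<open>Counting invariant exponents\<close>

text \<open>Both exponents of the block grow by one. Together with \<open>sum_raise\<close> this
  makes the invariant exponents of a given degree closed under trades.\<close>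

lemma weight_raise: "weight (raise j \<alpha>) = weight \<alpha>"
  by (simp add: weight_def raise_def vec_eq_iff)

definition invariant_exponents ::
    "(int ^ 'n::finite) set \<Rightarrow> nat \<Rightarrow> ('n \<times> 2 \<Rightarrow> nat) set" where
  "invariant_exponents L k = {\<alpha>. sum \<alpha> UNIV = k \<and> weight \<alpha> \<in> L}"

text \<open>\<open>A\<close> is the set of indices at which divisibility by \<open>z_j w_j\<close>
  is allowed. It interpolates between lattice points (\<open>A = {}\<close>) and the exponents
  indexing the basis (\<open>A = UNIV - {k}\<close>).\<close>

definition reduced_exponents ::
    "(int ^ 'n::finite) set \<Rightarrow> 'n set \<Rightarrow> nat \<Rightarrow> ('n \<times> 2 \<Rightarrow> nat) set" where
  "reduced_exponents L A k =
    {\<alpha> \<in> invariant_exponents L k. \<forall>j. j \<notin> A \<longrightarrow> \<alpha> (j, 1) = 0 \<or> \<alpha> (j, 2) = 0}"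

lemma finite_invariant_exponents: "finite (invariant_exponents L k)"
  by (rule finite_subset[OF _ finite_functions_sum_eq[of k]]) (auto simp: invariant_exponents_def)

lemma finite_reduced_exponents: "finite (reduced_exponents L A k)"
  by (rule finite_subset[OF _ finite_invariant_exponents[of L k]]) (auto simp: reduced_exponents_def)

text \<open>If each block has a zero exponent, the two exponents are the positive and negative parts
  of the weight, and their total is its one-norm.\<close>

lemma card_reduced_exponents_empty:
  fixes L :: "(int ^ 'n::finite) set"
  shows "card (reduced_exponents L {} k) = card {\<mu> \<in> L. one_norm \<mu> = int k}"
proof (rule bij_betw_same_card)
  let ?inv = "\<lambda>(\<mu> :: int ^ 'n) u. nat (if snd u = (1::2) then \<mu> $ fst u else - \<mu> $ fst u)"
  have w: "weight (?inv \<mu>) = \<mu>" for \<mu>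
    by (simp add: weight_def vec_eq_iff)
  have norm: "one_norm (weight \<alpha>) = int (sum \<alpha> UNIV)"
    if "\<forall>j. \<alpha> (j, 1) = 0 \<or> \<alpha> (j, 2) = 0" for \<alpha> :: "'n \<times> 2 \<Rightarrow> nat"
  proof -
    have "\<bar>int (\<alpha> (j, 1)) - int (\<alpha> (j, 2))\<bar> = int (\<alpha> (j, 1) + \<alpha> (j, 2))" for j
      using that[rule_format, of j] by auto
    then show ?thesis unfolding one_norm_def weight_def sum_pair_2[of \<alpha>] by simp
  qed
  show "bij_betw weight (reduced_exponents L {} k) {\<mu> \<in> L. one_norm \<mu> = int k}"
  proof (rule bij_betwI[where g = ?inv])
    show "weight \<in> reduced_exponents L {} k \<rightarrow> {\<mu> \<in> L. one_norm \<mu> = int k}"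
      by (auto simp: reduced_exponents_def invariant_exponents_def norm)
    show "?inv \<in> {\<mu> \<in> L. one_norm \<mu> = int k} \<rightarrow> reduced_exponents L {} k"
    proof
      fix \<mu> assume \<mu>: "\<mu> \<in> {\<mu> \<in> L. one_norm \<mu> = int k}"
      have red: "\<forall>j. ?inv \<mu> (j, 1) = 0 \<or> ?inv \<mu> (j, 2) = 0" by auto
      have "int (sum (?inv \<mu>) UNIV) = int k" using norm[OF red] \<mu> unfolding w by simp
      then have "sum (?inv \<mu>) UNIV = k" by (simp only: of_nat_eq_iff)
      then show "?inv \<mu> \<in> reduced_exponents L {} k"
        using \<mu> w red unfolding reduced_exponents_def invariant_exponents_def by simp
    qed
    show "?inv (weight \<alpha>) = \<alpha>" if \<alpha>: "\<alpha> \<in> reduced_exponents L {} k" for \<alpha>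
    proof
      fix u :: "'n \<times> 2"
      have "\<alpha> (fst u, 1) = 0 \<or> \<alpha> (fst u, 2) = 0" using \<alpha> by (simp add: reduced_exponents_def)
      then show "?inv (weight \<alpha>) u = \<alpha> u"
        using exhaust_2[of "snd u"] by (cases u) (auto simp: weight_def)
    qed
  qed (rule w)
qed

section \<open>Generating functions of the reduced exponents\<close>

definition reduced_gf :: "(int ^ 'n::finite) set \<Rightarrow> 'n set \<Rightarrow> real fps" where
  "reduced_gf L A = Abs_fps (\<lambda>k. of_nat (card (reduced_exponents L A k)))"

lemma reduced_gf_empty: "reduced_gf L {} = one_norm_theta L"
  by (simp add: reduced_gf_def one_norm_theta_def card_reduced_exponents_empty)

text \<open>Split by divisibility by \<open>z_j w_j\<close>: the divisible exponents are the images
  under \<open>raise j\<close> of those two degrees lower, and there are none for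
  \<open>k < 2\<close>.\<close>

lemma card_reduced_exponents_insert:
  assumes "j \<notin> A"
  shows "card (reduced_exponents L (insert j A) k) = card (reduced_exponents L A k) +
    (if k < 2 then 0 else card (reduced_exponents L (insert j A) (k - 2)))"
proof -
  let ?R = "\<lambda>k. reduced_exponents L (insert j A) k"
  let ?P = "{\<alpha> \<in> ?R k. \<alpha> (j, 1) > 0 \<and> \<alpha> (j, 2) > 0}"
  have iff: "\<alpha> \<in> reduced_exponents L A k \<longleftrightarrow> \<alpha> \<in> ?R k \<and> (\<alpha> (j, 1) = 0 \<or> \<alpha> (j, 2) = 0)" for \<alpha>
  proof -
    have "(\<forall>i. i \<notin> A \<longrightarrow> P i) \<longleftrightarrow> (\<forall>i. i \<notin> insert j A \<longrightarrow> P i) \<and> P j" for P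
      using assms by (metis insert_iff)
    from this[of "\<lambda>i. \<alpha> (i, 1) = 0 \<or> \<alpha> (i, 2) = 0"] show ?thesis
      unfolding reduced_exponents_def mem_Collect_eq by (simp only: conj_assoc)
  qed
  have split: "?R k = reduced_exponents L A k \<union> ?P" "reduced_exponents L A k \<inter> ?P = {}"
    by (auto simp: iff)
  have "finite ?P" by (rule finite_subset[OF _ finite_reduced_exponents]) blast
  then have "card (?R k) = card (reduced_exponents L A k) + card ?P"
    by (subst split(1), intro card_Un_disjoint finite_reduced_exponents split(2))
  moreover have "card ?P = (if k < 2 then 0 else card (?R (k - 2)))"
  proof (cases "k < 2")
    case True
    have "\<alpha> \<notin> ?P" for \<alpha>
    proof
      assume \<alpha>: "\<alpha> \<in> ?P"
      have "sum (raise j (lower j \<alpha>)) UNIV = k"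
        using \<alpha> by (simp add: raise_lower reduced_exponents_def invariant_exponents_def)
      then show False unfolding sum_raise using True by simp
    qed
    then have "?P = {}" by blast
    then show ?thesis using True by (simp only: card.empty if_True)
  next
    case False
    have "bij_betw (raise j) (?R (k - 2)) ?P"
    proof (rule bij_betwI[where g = "lower j"])
      show "raise j \<in> ?R (k - 2) \<rightarrow> ?P"
        using False by (auto simp: reduced_exponents_def invariant_exponents_def sum_raise weight_raise)
          (auto simp: raise_def)
      show "lower j \<in> ?P \<rightarrow> ?R (k - 2)"
      proof
        fix \<alpha> assume \<alpha>: "\<alpha> \<in> ?P"
        then have eq: "raise j (lower j \<alpha>) = \<alpha>" by (simp add: raise_lower)
        show "lower j \<alpha> \<in> ?R (k - 2)"
          using \<alpha> sum_raise[of j "lower j \<alpha>"] weight_raise[of j "lower j \<alpha>"] unfolding eq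
          by (auto simp: reduced_exponents_def invariant_exponents_def) (auto simp: lower_def)
      qed
    qed (auto simp: raise_lower lower_raise)
    then show ?thesis using False bij_betw_same_card by fastforce
  qed
  ultimately show ?thesis by simp
qed

lemma reduced_gf_insert:
  assumes "j \<notin> A"
  shows "reduced_gf L (insert j A) * (1 - fps_X ^ 2) = reduced_gf L A"
proof (rule fps_ext)
  fix k
  have "real (card (reduced_exponents L (insert j A) k)) = real (card (reduced_exponents L A k)) +
      (if k < 2 then 0 else real (card (reduced_exponents L (insert j A) (k - 2))))"
    by (subst card_reduced_exponents_insert[OF assms]) simp
  then show "fps_nth (reduced_gf L (insert j A) * (1 - fps_X ^ 2)) k = fps_nth (reduced_gf L A) k"
    unfolding right_diff_distrib fps_sub_nth fps_X_power_mult_right_nth mult_1_right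
      reduced_gf_def fps_nth_Abs_fps by (simp only: add_diff_cancel_right')
qed

text \<open>Admit the indices of \<open>A\<close> one at a time; each contributes the geometric
  series of the powers of \<open>z_j w_j\<close>, which \<open>1 - fps_X ^ 2\<close>
  cancels.\<close>

lemma reduced_gf_mult:
  "reduced_gf L A * (1 - fps_X ^ 2) ^ card A = one_norm_theta L"
proof -
  have "finite A" by simp
  then show ?thesis
  proof (induction A rule: finite_induct)
    case empty
    show ?case by (simp add: reduced_gf_empty)
  next
    case (insert j A)
    have "reduced_gf L (insert j A) * (1 - fps_X ^ 2) ^ card (insert j A) =
        reduced_gf L (insert j A) * (1 - fps_X ^ 2) * (1 - fps_X ^ 2) ^ card A"
      unfolding card_insert_disjoint[OF insert.hyps] power_Suc mult.assoc ..
    then show ?case by (simp only: reduced_gf_insert[OF insert.hyps(2)] insert.IH)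
  qed
qed

section \<open>Harmonic invariants of the lens group and the main identity\<close>

lemma lens_matrix_SO: "lens_matrix q s \<in> carrier SO_group"
  by (simp add: SO_group_def lens_matrix_eq_rot orthogonal_matrix_rot det_rot)

text \<open>The generator multiplies each coefficient by its eigenvalue, so by independence a
  nonzero coefficient requires the eigenvalue 1.\<close>

lemma lens_invariant_iff:
  fixes s :: "int ^ 'n"
  assumes q: "q \<ge> 1" and f: "f = (\<lambda>x. \<Sum>\<alpha> | sum \<alpha> UNIV = k. c \<alpha> * zmono \<alpha> x)"
  shows "(\<forall>g\<in>lens_group q s. act g f = f) \<longleftrightarrow>
    (\<forall>\<alpha>. sum \<alpha> UNIV = k \<longrightarrow> c \<alpha> \<noteq> 0 \<longrightarrow> weight \<alpha> \<in> congruence_lattice q s)"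
proof -
  let ?S = "{\<alpha> :: 'n \<times> 2 \<Rightarrow> nat. sum \<alpha> UNIV = k}"
  obtain e where e: "\<And>\<alpha> x. zmono \<alpha> (lens_matrix q s *v x) = e \<alpha> * zmono \<alpha> x"
    "\<And>\<alpha>. e \<alpha> = 1 \<longleftrightarrow> weight \<alpha> \<in> congruence_lattice q s"
    using zmono_lens_matrix_eq_iff[OF q, of _ s] by metis
  have diff: "f (lens_matrix q s *v x) - f x = (\<Sum>\<alpha>\<in>?S. (c \<alpha> * (e \<alpha> - 1)) * zmono \<alpha> x)" for x
    unfolding f e sum_subtractf[symmetric] by (simp add: algebra_simps)
  have "(\<forall>g\<in>lens_group q s. act g f = f) \<longleftrightarrow> (\<forall>x. f (lens_matrix q s *v x) - f x = 0)"
    unfolding lens_group_def generate_SO_invariant_iff[OF lens_matrix_SO] by simp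
  also have "\<dots> \<longleftrightarrow> (\<forall>\<alpha>\<in>?S. c \<alpha> * (e \<alpha> - 1) = 0)"
    unfolding diff
  proof
    assume "\<forall>x. (\<Sum>\<alpha>\<in>?S. (c \<alpha> * (e \<alpha> - 1)) * zmono \<alpha> x) = 0"
    then show "\<forall>\<alpha>\<in>?S. c \<alpha> * (e \<alpha> - 1) = 0"
      using zmono_independent[OF finite_functions_sum_eq, where k1 = k and c = "\<lambda>\<alpha>. c \<alpha> * (e \<alpha> - 1)"]
      by simp
  next
    assume "\<forall>\<alpha>\<in>?S. c \<alpha> * (e \<alpha> - 1) = 0"
    then show "\<forall>x. (\<Sum>\<alpha>\<in>?S. (c \<alpha> * (e \<alpha> - 1)) * zmono \<alpha> x) = 0"
      by (intro allI sum.neutral) simp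
  qed
  finally show ?thesis using e(2) by auto
qed

text \<open>Independence yields the relations two degrees below \<open>k\<close>; in all other
  degrees they hold because every coefficient in them vanishes.\<close>

lemma harmonic_iff:
  fixes c :: "('n::finite \<times> 2 \<Rightarrow> nat) \<Rightarrow> complex"
  assumes supp: "\<And>\<alpha>. sum \<alpha> UNIV \<noteq> k \<Longrightarrow> c \<alpha> = 0"
  shows "(\<forall>x. laplacian (\<lambda>x. \<Sum>\<alpha> | sum \<alpha> UNIV = k. c \<alpha> * zmono \<alpha> x) x = 0) \<longleftrightarrow>
    (\<forall>\<beta>. (\<Sum>j\<in>UNIV. of_nat (raise j \<beta> (j, 1) * raise j \<beta> (j, 2)) * c (raise j \<beta>)) = 0)"
    (is "?lhs \<longleftrightarrow> (\<forall>\<beta>. ?l \<beta> = 0)")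
proof
  assume lhs: ?lhs
  show "\<forall>\<beta>. ?l \<beta> = 0"
  proof
    fix \<beta> :: "'n \<times> 2 \<Rightarrow> nat"
    show "?l \<beta> = 0"
    proof (cases "sum \<beta> UNIV + 2 = k")
      case True
      have fin: "finite {\<beta> :: 'n \<times> 2 \<Rightarrow> nat. sum \<beta> UNIV + 2 = k}"
        by (rule finite_subset[OF _ finite_functions_sum_eq[of "k - 2"]]) auto
      show ?thesis
        using zmono_independent[OF fin, of ?l \<beta>] lhs True by (simp add: laplacian_homogeneous)
    next
      case False
      then show ?thesis by (intro sum.neutral) (simp add: supp sum_raise)
    qed
  qed
qed (simp add: laplacian_homogeneous)

lemma harmonic_invariants_lens_group:
  fixes s :: "int ^ 'n"
  assumes q: "q \<ge> 1"
  defines "S \<equiv> invariant_exponents (congruence_lattice q s)"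
  shows "harmonic_invariants (lens_group q s) k =
    (\<lambda>c x. \<Sum>\<alpha>\<in>S k. c \<alpha> * zmono \<alpha> x) ` harmonic_coeffs (S k)"
proof -
  let ?D = "{\<alpha> :: 'n \<times> 2 \<Rightarrow> nat. sum \<alpha> UNIV = k}"
  have S: "S k = {\<alpha> \<in> ?D. weight \<alpha> \<in> congruence_lattice q s}"
    by (auto simp: S_def invariant_exponents_def)
  have ext: "(\<lambda>x. \<Sum>\<alpha>\<in>S k. c \<alpha> * zmono \<alpha> x) = (\<lambda>x. \<Sum>\<alpha>\<in>?D. c \<alpha> * zmono \<alpha> x)"
    if "\<And>\<alpha>. \<alpha> \<notin> S k \<Longrightarrow> c \<alpha> = 0" for c
    using that by (intro ext sum.mono_neutral_left finite_functions_sum_eq) (auto simp: S)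
  show ?thesis
  proof (intro equalityI subsetI)
    fix f assume f: "f \<in> harmonic_invariants (lens_group q s) k"
    then obtain c' where c': "f = (\<lambda>x. \<Sum>\<alpha>\<in>?D. c' \<alpha> * zmono \<alpha> x)"
      unfolding harmonic_invariants_def harmonic_poly_def homogeneous_poly_eq by blast
    \<comment> \<open>\<open>c'\<close> is arbitrary outside degree \<open>k\<close>; cutting it off
      there gives the support condition of \<open>harmonic_coeffs\<close>.\<close>
    define c where "c \<alpha> = (if \<alpha> \<in> ?D then c' \<alpha> else 0)" for \<alpha>
    have c: "f = (\<lambda>x. \<Sum>\<alpha>\<in>?D. c \<alpha> * zmono \<alpha> x)" unfolding c' c_def by simp
    have "\<forall>g\<in>lens_group q s. act g f = f" using f unfolding harmonic_invariants_def by blast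
    then have supp: "c \<alpha> = 0" if "\<alpha> \<notin> S k" for \<alpha>
      using that unfolding lens_invariant_iff[OF q c] S by (auto simp: c_def)
    have "\<forall>x. laplacian f x = 0" using f unfolding harmonic_invariants_def harmonic_poly_def by blast
    then have "c \<in> harmonic_coeffs (S k)"
      unfolding c using harmonic_iff[where k = k and c = c] supp by (auto simp: c_def harmonic_coeffs_def)
    then show "f \<in> (\<lambda>c x. \<Sum>\<alpha>\<in>S k. c \<alpha> * zmono \<alpha> x) ` harmonic_coeffs (S k)"
      using c ext[of c] supp by (intro image_eqI[of _ _ c]) auto
  next
    fix f assume "f \<in> (\<lambda>c x. \<Sum>\<alpha>\<in>S k. c \<alpha> * zmono \<alpha> x) ` harmonic_coeffs (S k)"
    then obtain c where c: "c \<in> harmonic_coeffs (S k)" "f = (\<lambda>x. \<Sum>\<alpha>\<in>S k. c \<alpha> * zmono \<alpha> x)"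
      by blast
    have supp: "c \<alpha> = 0" if "\<alpha> \<notin> S k" for \<alpha> using that c(1) unfolding harmonic_coeffs_def by blast
    have f: "f = (\<lambda>x. \<Sum>\<alpha>\<in>?D. c \<alpha> * zmono \<alpha> x)" unfolding c(2) using supp by (rule ext)
    have "\<forall>x. laplacian f x = 0"
      unfolding f using harmonic_iff[where k = k and c = c] supp c(1) by (auto simp: S harmonic_coeffs_def)
    moreover have "\<forall>g\<in>lens_group q s. act g f = f"
      unfolding lens_invariant_iff[OF q f] using supp by (auto simp: S)
    ultimately show "f \<in> harmonic_invariants (lens_group q s) k"
      unfolding harmonic_invariants_def harmonic_poly_def homogeneous_poly_eq using f by blast
  qed
qed

theorem theorem3p1:
  fixes q :: nat and s :: "int ^ 'n"
  assumes "CARD('n) \<ge> 2"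
    and "q \<ge> 1"
    and "Gcd (insert (int q) (range (\<lambda>j. s $ j))) = 1"
  shows "lens_spectral_gf q s =
    one_norm_theta (congruence_lattice q s) / (1 - fps_X ^ 2) ^ (CARD('n) - 1)"
proof -
  let ?L = "congruence_lattice q s"
  \<comment> \<open>Any index can serve as the one solved for; the type is nonempty.\<close>
  define k :: 'n where "k = undefined"
  have "cfun.dim (harmonic_invariants (lens_group q s) m) =
      card (reduced_exponents ?L (UNIV - {k}) m)" for m
  proof -
    have "{\<alpha> \<in> invariant_exponents ?L m. \<alpha> (k, 1) = 0 \<or> \<alpha> (k, 2) = 0} =
        reduced_exponents ?L (UNIV - {k}) m"
      by (auto simp: reduced_exponents_def)
    then show ?thesis
      unfolding harmonic_invariants_lens_group[OF assms(2)]
      by (subst dim_harmonic_coeffs[OF finite_invariant_exponents, where k = k])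
        (auto simp: invariant_exponents_def sum_raise weight_raise)
  qed
  then have "lens_spectral_gf q s = reduced_gf ?L (UNIV - {k})"
    by (simp add: lens_spectral_gf_def spectral_gf_def reduced_gf_def)
  moreover have "reduced_gf ?L (UNIV - {k}) * (1 - fps_X ^ 2) ^ (CARD('n) - 1) = one_norm_theta ?L"
    using reduced_gf_mult[of ?L "UNIV - {k}"] by (simp add: card_Diff_singleton)
  \<comment> \<open>Cancelling the power in the quotient requires a nonzero divisor; the constant
    coefficient here is 1.\<close>
  moreover have "(1 - fps_X ^ 2 :: real fps) \<noteq> 0"
  proof
    assume "(1 - fps_X ^ 2 :: real fps) = 0"
    from arg_cong[OF this, of "\<lambda>f. fps_nth f 0"] show False by simp
  qed
  ultimately show ?thesis
    using nonzero_mult_div_cancel_right[of "(1 - fps_X ^ 2) ^ (CARD('n) - 1)" "lens_spectral_gf q s"]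
    by simp
qed

end
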